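(* Let $S=S^{n-1}\subseteq\mathbb{R}^n$ be the unit sphere, let $C=\{q_1,\dots,q_N\}\subseteq S$ be a set of $N$ distinct points, let $f_1,\dots,f_m:S\to\mathbb{R}$ be functions, and let $M\in\mathbb{R}^{m\times N}$ be the matrix with entries $M_{ij}=f_i(q_j)$. Let $k$ be a positive integer and assume that $\delta_{2k}(M)<\sqrt{2}-1$. Then there exists a constant $B_1$ such that the following hold for every point measure $\mu=\sum_{i=1}^k g_i\delta_{y_i}$ with $y_i\in S$ and $g_i\in\mathbb{R}_+$, with vector of moments $b_\mu\in\mathbb{R}^m$. (1) (Exact recovery) If $\mathrm{supp}(\mu)\subseteq C$ and $c^*\in\mathbb{R}^N$ is a minimizer of the problem $$\min \|c\|_1\ \text{ subject to } Mc=b_\mu,$$ then $\mu=\sum_{i=1}^N c_i^*\delta_{q_i}$. (2) (Approximate recovery) Let $\tau\ge 0$ and assume there exists a point measure $\nu$ supported on at most $k$ points of $C$, with coefficient vector $c_\nu\in\mathbb{R}^N$ (so $\nu=\sum_{i=1}^N (c_\nu)_i\delta_{q_i}$ and $c_\nu$ is $k$-sparse), such that $\|b_\mu-b_\nu\|_2\le\tau$. If $c^*\in\mathbb{R}^N$ is a minimizer of the problem $$\min\|c\|_1\ \text{ subject to } \|Mc-b_\mu\|_2\le\tau,$$ then $\|c^*-c_\nu\|_2\le B_1\tau$.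
   Context: A vector in $\mathbb{R}^N$ is $s$-sparse if it has at most $s$ nonzero components. For $A\in\mathbb{R}^{m\times N}$, the $s$-th restricted isometry constant $\delta_s(A)$ is the smallest real number $\delta_s$ such that $(1-\delta_s)\|x\|_2^2\le\|Ax\|_2^2\le(1+\delta_s)\|x\|_2^2$ for all $s$-sparse $x\in\mathbb{R}^N$. A point measure on $S$ is a finite linear combination of Dirac measures $\sum c_i\delta_{p_i}$ with $p_i\in S$ and coefficients $c_i\in\mathbb{R}_+$ (nonnegative). For a point measure $\nu$, its vector of moments with respect to $f_1,\dots,f_m$ is $b_\nu\in\mathbb{R}^m$ with $(b_\nu)_j=\int_S f_j\,d\nu$. *)

theory Defs
  imports "HOL-Probability.Giry_Monad"
begin

definition sparse_vec :: "nat \<Rightarrow> real ^ 'n \<Rightarrow> bool" where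
  "sparse_vec s x \<longleftrightarrow> card {i. x $ i \<noteq> 0} \<le> s"

definition l1_norm :: "real ^ 'n \<Rightarrow> real" where
  "l1_norm x = (\<Sum>i\<in>UNIV. \<bar>x $ i\<bar>)"

definition rip_bound :: "real ^ 'n ^ 'm \<Rightarrow> nat \<Rightarrow> real \<Rightarrow> bool" where
  "rip_bound A s \<delta> \<longleftrightarrow>
    (\<forall>x. sparse_vec s x \<longrightarrow>
      (1 - \<delta>) * (norm x)\<^sup>2 \<le> (norm (A *v x))\<^sup>2 \<and>
      (norm (A *v x))\<^sup>2 \<le> (1 + \<delta>) * (norm x)\<^sup>2)"

text \<open>The least admissible constant exists whenever \<open>s > 0\<close>, see \<open>rip_bound_rip_const\<close> below.
  (For \<open>s = 0\<close> every real number is admissible, so there is no least one.)\<close>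

definition rip_const :: "real ^ 'n ^ 'm \<Rightarrow> nat \<Rightarrow> real" where
  "rip_const A s = (LEAST \<delta>. rip_bound A s \<delta>)"

text \<open>Measures live on the full power set of \<open>S\<close>, so that an arbitrary function on \<open>S\<close>
  can be integrated against a point measure.\<close>

definition dirac :: "'a set \<Rightarrow> 'a \<Rightarrow> 'a measure" where
  "dirac S p = return (count_space S) p"

text \<open>The measure \<open>\<Sum>i\<in>I. c i \<cdot> \<delta>(p i)\<close>. It is only meaningful for nonnegative
  coefficients, since \<open>ennreal\<close> truncates negative numbers to zero.\<close>

definition point_meas :: "'a set \<Rightarrow> 'i set \<Rightarrow> ('i \<Rightarrow> real) \<Rightarrow> ('i \<Rightarrow> 'a) \<Rightarrow> 'a measure" where
  "point_meas S I c p =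
    measure_of S (Pow S) (\<lambda>A. \<Sum>i\<in>I. ennreal (c i) * emeasure (dirac S (p i)) A)"

definition measure_support :: "'a::topological_space measure \<Rightarrow> 'a set" where
  "measure_support \<mu> =
    {x \<in> space \<mu>. \<forall>U. open U \<longrightarrow> x \<in> U \<longrightarrow> 0 < emeasure \<mu> (U \<inter> space \<mu>)}"

definition moments :: "('m \<Rightarrow> 'a \<Rightarrow> real) \<Rightarrow> 'a measure \<Rightarrow> real ^ 'm" where
  "moments f \<mu> = (\<chi> j. integral\<^sup>L \<mu> (f j))"

lemma space_point_meas [simp]: "space (point_meas S I c p) = S"
  and sets_point_meas [simp]: "sets (point_meas S I c p) = Pow S"
  by (simp_all add: point_meas_def sigma_algebra.sigma_sets_eq[OF sigma_algebra_Pow])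

lemma emeasure_point_meas:
  assumes "A \<subseteq> S"
  shows "emeasure (point_meas S I c p) A =
    (\<Sum>i\<in>I. ennreal (c i) * emeasure (dirac S (p i)) A)"
proof (rule emeasure_measure_of[OF point_meas_def])
  show "countably_additive (sets (point_meas S I c p))
    (\<lambda>A. \<Sum>i\<in>I. ennreal (c i) * emeasure (dirac S (p i)) A)"
  proof (rule countably_additiveI)
    fix F :: "nat \<Rightarrow> 'a set"
    assume F: "range F \<subseteq> sets (point_meas S I c p)" "disjoint_family F"
    have "(\<Sum>n. ennreal (c i) * emeasure (dirac S (p i)) (F n))
        = ennreal (c i) * emeasure (dirac S (p i)) (\<Union>n. F n)" for i
    proof -
      have "range F \<subseteq> sets (dirac S (p i))"
        using F(1) by (simp add: dirac_def)
      then show ?thesis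
        using F(2) by (simp add: suminf_emeasure)
    qed
    then show "(\<Sum>n. \<Sum>i\<in>I. ennreal (c i) * emeasure (dirac S (p i)) (F n))
        = (\<Sum>i\<in>I. ennreal (c i) * emeasure (dirac S (p i)) (\<Union>n. F n))"
      by (subst suminf_sum) (auto intro: summableI)
  qed
qed (use assms in \<open>auto simp: positive_def\<close>)

lemma emeasure_dirac: "A \<subseteq> S \<Longrightarrow> emeasure (dirac S p) A = indicator A p"
  by (simp add: dirac_def)

lemma rip_bound_rip_const:
  fixes A :: "real ^ 'n ^ 'm"
  assumes "0 < s"
  shows "rip_bound A s (rip_const A s)"
    and "rip_bound A s \<delta> \<Longrightarrow> rip_const A s \<le> \<delta>"
proof -
  let ?D = "{\<delta>. rip_bound A s \<delta>}"
  obtain i0 :: 'n where True by simp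
  have sp: "sparse_vec s (axis i0 1 :: real ^ 'n)"
  proof -
    have "{i. (axis i0 1 :: real ^ 'n) $ i \<noteq> 0} = {i0}" by (auto simp: axis_def)
    then show ?thesis using assms by (simp add: sparse_vec_def)
  qed
  have ge0: "0 \<le> \<delta>" if "\<delta> \<in> ?D" for \<delta>
  proof -
    have "(1 - \<delta>) * (norm (axis i0 1 :: real ^ 'n))\<^sup>2
        \<le> (1 + \<delta>) * (norm (axis i0 1 :: real ^ 'n))\<^sup>2"
      using that sp unfolding rip_bound_def mem_Collect_eq by (meson order_trans)
    then show ?thesis by simp
  qed
  have bdd: "bdd_below ?D" using ge0 by (meson bdd_belowI)
  have "?D = (\<Inter>x\<in>{x. sparse_vec s x}.
      {\<delta>. (1 - \<delta>) * (norm x)\<^sup>2 \<le> (norm (A *v x))\<^sup>2} \<inter>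
      {\<delta>. (norm (A *v x))\<^sup>2 \<le> (1 + \<delta>) * (norm x)\<^sup>2})"
    by (auto simp: rip_bound_def)
  moreover have "closed \<dots>"
    by (intro closed_INT ballI closed_Int closed_Collect_le continuous_intros)
  ultimately have cl: "closed ?D" by simp
  have "?D \<noteq> {}"
  proof -
    define K where "K = onorm ((*v) A)"
    have "rip_bound A s (1 + K\<^sup>2)"
      unfolding rip_bound_def
    proof (intro allI impI conjI)
      fix x :: "real ^ 'n"
      have "norm (A *v x) \<le> K * norm x"
        unfolding K_def by (rule onorm) (rule matrix_vector_mul_bounded_linear)
      then have "(norm (A *v x))\<^sup>2 \<le> (K * norm x)\<^sup>2"
        by (rule power_mono) simp
      also have "\<dots> \<le> (1 + (1 + K\<^sup>2)) * (norm x)\<^sup>2"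
        by (simp add: power_mult_distrib algebra_simps)
      finally show "(norm (A *v x))\<^sup>2 \<le> (1 + (1 + K\<^sup>2)) * (norm x)\<^sup>2" .
      have "(1 - (1 + K\<^sup>2)) * (norm x)\<^sup>2 \<le> 0"
        by (simp add: mult_nonpos_nonneg)
      also have "0 \<le> (norm (A *v x))\<^sup>2" by simp
      finally show "(1 - (1 + K\<^sup>2)) * (norm x)\<^sup>2 \<le> (norm (A *v x))\<^sup>2" .
    qed
    then show ?thesis by auto
  qed
  then have "Inf ?D \<in> ?D" using bdd cl by (rule closed_contains_Inf)
  moreover have lower: "Inf ?D \<le> \<delta>" if "rip_bound A s \<delta>" for \<delta>
    using bdd that by (auto intro: cInf_lower)
  ultimately have eq: "rip_const A s = Inf ?D"
    unfolding rip_const_def by (intro Least_equality) auto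
  show "rip_bound A s (rip_const A s)" using \<open>Inf ?D \<in> ?D\<close> eq by simp
  show "rip_bound A s \<delta> \<Longrightarrow> rip_const A s \<le> \<delta>" using lower eq by simp
qed

end

theory Submission
  imports Defs
begin

text \<open>
  The theorem rests on a deterministic fact about the matrix, \<open>rip_l1_error_bound\<close>: under the
  restricted isometry condition, a vector \<open>z\<close> with \<open>\<parallel>z\<parallel>\<^sub>1 \<le> \<parallel>x\<parallel>\<^sub>1\<close> and \<open>\<parallel>A (z - x)\<parallel> \<le> \<epsilon>\<close> lies within a
  constant times \<open>\<epsilon>\<close> of the sparse vector \<open>x\<close>. The argument is that of Candes. Let \<open>h = z - x\<close>
  and let \<open>T0\<close> be the support of \<open>x\<close>. The \<open>\<ell>\<^sub>1\<close> hypothesis puts at least half of the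
  \<open>\<ell>\<^sub>1\<close> mass of \<open>h\<close> on \<open>T0\<close>. If \<open>T1\<close> carries the \<open>k\<close> largest entries of \<open>h\<close> off \<open>T0\<close>, then all the
  remaining entries together are, in the weak sense of \<open>top_entries_tail_bound\<close>, dominated by
  \<open>\<parallel>h\<^sub>T\<^sub>0\<parallel>\<^sub>2\<close>, so it suffices to bound \<open>h\<close> on \<open>T0 \<union> T1\<close>. There \<open>A\<close> is almost an isometry, and it
  almost preserves the orthogonality of disjoint sparse vectors (\<open>rip_disjoint_inner\<close>), hence
  \<open>(1 - \<delta>) \<parallel>h\<^sub>0\<^sub>1\<parallel> \<le> sqrt (1 + \<delta>) \<epsilon> + sqrt 2 \<delta> \<parallel>h\<^sub>0\<^sub>1\<parallel>\<close>. The last term can be absorbed on the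
  left exactly when \<open>\<delta> < sqrt 2 - 1\<close>, and the triangle inequality then bounds \<open>h\<close> itself.

  The measures enter only through linear algebra: integrating against a point measure carried by
  \<open>range q\<close> is multiplying its coefficient vector by \<open>M\<close>. For the approximate part, both the
  minimizer and \<open>c\<^sub>\<nu>\<close> are feasible, so their images under \<open>M\<close> differ by at most \<open>2 \<tau>\<close>. For the
  exact part, the hypothesis on the support lets the weights of \<open>\<mu>\<close> be collected into a
  \<open>k\<close>-sparse feasible vector, and the error bound with \<open>\<epsilon> = 0\<close> shows that it is the minimizer.
\<close>

section \<open>Restriction of vectors to index sets\<close>

definition vec_restrict :: "'n set \<Rightarrow> real ^ 'n \<Rightarrow> real ^ 'n" where
  "vec_restrict T h = (\<chi> i. if i \<in> T then h $ i else 0)"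

lemma vec_restrict_nth [simp]: "vec_restrict T h $ i = (if i \<in> T then h $ i else 0)"
  by (simp add: vec_restrict_def)

lemma vec_restrict_empty [simp]: "vec_restrict {} h = 0"
  by (simp add: vec_eq_iff)

lemma vec_restrict_Un:
  "T \<inter> U = {} \<Longrightarrow> vec_restrict (T \<union> U) h = vec_restrict T h + vec_restrict U h"
  by (auto simp: vec_eq_iff)

lemma sparse_vec_restrict:
  fixes h :: "real ^ 'n"
  assumes "card T \<le> s"
  shows "sparse_vec s (vec_restrict T h)"
proof -
  have "card {i. vec_restrict T h $ i \<noteq> 0} \<le> card T"
    by (rule card_mono) auto
  with assms show ?thesis by (simp add: sparse_vec_def)
qed

lemma norm_squared_vec: "(norm (x :: real ^ 'n))\<^sup>2 = (\<Sum>i\<in>UNIV. (x $ i)\<^sup>2)"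
  unfolding power2_norm_eq_inner inner_vec_def by (simp add: power2_eq_square)

lemma norm_squared_vec_restrict:
  fixes h :: "real ^ 'n"
  shows "(norm (vec_restrict T h))\<^sup>2 = (\<Sum>i\<in>T. (h $ i)\<^sup>2)"
  unfolding norm_squared_vec by (rule sum.mono_neutral_cong_right) auto

lemma inner_vec_restrict_disjoint:
  fixes h :: "real ^ 'n"
  assumes "T \<inter> U = {}"
  shows "vec_restrict T h \<bullet> vec_restrict U h = 0"
  unfolding inner_vec_def by (rule sum.neutral) (use assms in auto)

lemma l1_le_sqrt_card_mult_norm:
  fixes h :: "real ^ 'n"
  assumes "card T \<le> k"
  shows "(\<Sum>i\<in>T. \<bar>h $ i\<bar>) \<le> sqrt k * norm (vec_restrict T h)"
proof -
  have "(\<Sum>i\<in>T. \<bar>h $ i\<bar>) \<le> sqrt (card T) * norm (vec_restrict T h)"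
  proof (rule power2_le_imp_le)
    have "(\<Sum>i\<in>T. \<bar>h $ i\<bar>)\<^sup>2 \<le> (\<Sum>i\<in>T. \<bar>h $ i\<bar>\<^sup>2) * (\<Sum>i\<in>T. 1\<^sup>2)"
      using Cauchy_Schwarz_ineq_sum[of "\<lambda>i. \<bar>h $ i\<bar>" "\<lambda>i. 1" T] by simp
    then show "(\<Sum>i\<in>T. \<bar>h $ i\<bar>)\<^sup>2 \<le> (sqrt (card T) * norm (vec_restrict T h))\<^sup>2"
      by (simp add: power_mult_distrib norm_squared_vec_restrict mult.commute)
  qed simp
  also have "\<dots> \<le> sqrt k * norm (vec_restrict T h)"
    using assms by (intro mult_right_mono) auto
  finally show ?thesis .
qed

lemma norm_vec_restrict_le_sup:
  fixes h :: "real ^ 'n"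
  assumes "card T \<le> k" "0 \<le> \<beta>" "\<And>i. i \<in> T \<Longrightarrow> \<bar>h $ i\<bar> \<le> \<beta>"
  shows "norm (vec_restrict T h) \<le> sqrt k * \<beta>"
proof (rule power2_le_imp_le)
  have "(norm (vec_restrict T h))\<^sup>2 \<le> (\<Sum>i\<in>T. \<beta>\<^sup>2)"
    unfolding norm_squared_vec_restrict
  proof (rule sum_mono)
    fix i assume "i \<in> T"
    then show "(h $ i)\<^sup>2 \<le> \<beta>\<^sup>2"
      using power_mono[OF assms(3), of i 2] by simp
  qed
  also have "\<dots> \<le> k * \<beta>\<^sup>2"
    using assms by (simp add: mult_right_mono)
  finally show "(norm (vec_restrict T h))\<^sup>2 \<le> (sqrt k * \<beta>)\<^sup>2"
    by (simp add: power_mult_distrib)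
qed (use assms in simp)

section \<open>The tail after the largest entries\<close>

lemma exists_top_subset:
  fixes w :: "'a \<Rightarrow> real"
  assumes "finite U" "k \<le> card U"
  shows "\<exists>T\<subseteq>U. card T = k \<and> (\<forall>i\<in>T. \<forall>j\<in>U - T. w j \<le> w i)"
  using assms(2)
proof (induction k)
  case 0
  then show ?case by (intro exI[of _ "{}"]) auto
next
  case (Suc k)
  then obtain T where T: "T \<subseteq> U" "card T = k" "\<forall>i\<in>T. \<forall>j\<in>U - T. w j \<le> w i"
    by auto
  have fin: "finite T" "finite (U - T)" using T assms finite_subset by auto
  have "U - T \<noteq> {}"
    using T Suc.prems fin card_mono[of T U] by auto
  then have "Max (w ` (U - T)) \<in> w ` (U - T)" using fin by (intro Max_in) auto
  then obtain a where a: "a \<in> U - T" "w a = Max (w ` (U - T))" by auto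
  then have amax: "w j \<le> w a" if "j \<in> U - T" for j
    using that fin by simp
  show ?case
    using T a(1) amax fin by (intro exI[of _ "insert a T"]) auto
qed

text \<open>Averaging over the \<open>k\<close> largest entries bounds every entry that is left, with the \<open>\<ell>\<^sub>1\<close> mass
  of the removed block as the price. This is what makes the blocks of the tail telescope.\<close>

lemma exists_block_dominating_rest:
  fixes h :: "real ^ 'n"
  assumes "0 < k"
  obtains T where "T \<subseteq> U" "card T \<le> k" "U \<noteq> {} \<Longrightarrow> T \<noteq> {}"
    and "\<And>j. j \<in> U - T \<Longrightarrow> \<bar>h $ j\<bar> \<le> (\<Sum>i\<in>T. \<bar>h $ i\<bar>) / k"
proof (cases "card U \<le> k")
  case True
  then show ?thesis by (intro that[of U]) auto
next
  case False
  then obtain T where T: "T \<subseteq> U" "card T = k" "\<forall>i\<in>T. \<forall>j\<in>U - T. \<bar>h $ j\<bar> \<le> \<bar>h $ i\<bar>"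
    using exists_top_subset[of U k "\<lambda>i. \<bar>h $ i\<bar>"] by auto
  show ?thesis
  proof (rule that[of T])
    fix j assume "j \<in> U - T"
    then have "(\<Sum>i\<in>T. \<bar>h $ j\<bar>) \<le> (\<Sum>i\<in>T. \<bar>h $ i\<bar>)"
      using T by (intro sum_mono) auto
    then show "\<bar>h $ j\<bar> \<le> (\<Sum>i\<in>T. \<bar>h $ i\<bar>) / k"
      using T assms by (simp add: field_simps)
  qed (use T assms in auto)
qed

text \<open>Peel off the \<open>k\<close> largest entries: the block contributes at most \<open>D sqrt k \<beta>\<close>, and the new
  uniform bound for the rest is the average of the block, whose contribution
  \<open>sqrt k \<cdot> average\<close> is \<open>1 / sqrt k\<close> times the \<open>\<ell>\<^sub>1\<close> mass of the block. Working with an arbitrary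
  functional, bounded only on \<open>k\<close>-sparse vectors, covers both the norm of the tail and its
  interaction with a fixed vector under \<open>A\<close>, and no list of blocks has to be carried along.\<close>

lemma sparse_functional_bound:
  fixes h :: "real ^ 'n" and \<phi> :: "real ^ 'n \<Rightarrow> real"
  assumes "0 < k" "linear \<phi>" "0 \<le> D"
    and "\<And>T. T \<subseteq> U \<Longrightarrow> card T \<le> k \<Longrightarrow> \<bar>\<phi> (vec_restrict T h)\<bar> \<le> D * norm (vec_restrict T h)"
    and "0 \<le> \<beta>" "\<And>i. i \<in> U \<Longrightarrow> \<bar>h $ i\<bar> \<le> \<beta>"
  shows "\<bar>\<phi> (vec_restrict U h)\<bar> \<le> D * (sqrt k * \<beta> + (\<Sum>i\<in>U. \<bar>h $ i\<bar>) / sqrt k)"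
  using assms(4-6)
proof (induction "card U" arbitrary: U \<beta> rule: less_induct)
  case less
  show ?case
  proof (cases "U = {}")
    case True
    then show ?thesis using less.prems assms by (simp add: linear_0)
  next
    case False
    obtain T where T: "T \<subseteq> U" "card T \<le> k" "T \<noteq> {}"
      "\<And>j. j \<in> U - T \<Longrightarrow> \<bar>h $ j\<bar> \<le> (\<Sum>i\<in>T. \<bar>h $ i\<bar>) / k"
      using exists_block_dominating_rest[OF assms(1), of U h] False by metis
    define m where "m = (\<Sum>i\<in>T. \<bar>h $ i\<bar>)"
    have m: "0 \<le> m" by (simp add: m_def sum_nonneg)
    have "card (U - T) < card U"
      using T by (intro psubset_card_mono) auto
    then have rest: "\<bar>\<phi> (vec_restrict (U - T) h)\<bar>
        \<le> D * (sqrt k * (m / k) + (\<Sum>i\<in>U - T. \<bar>h $ i\<bar>) / sqrt k)"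
    proof (intro less.hyps)
      fix V assume "V \<subseteq> U - T" "card V \<le> k"
      then show "\<bar>\<phi> (vec_restrict V h)\<bar> \<le> D * norm (vec_restrict V h)"
        using less.prems(1)[of V] by blast
    qed (use T m in \<open>simp_all add: m_def\<close>)
    have "\<bar>\<phi> (vec_restrict T h)\<bar> \<le> D * norm (vec_restrict T h)"
      using T less.prems by auto
    also have "\<dots> \<le> D * (sqrt k * \<beta>)"
      using T less.prems assms(3) by (intro mult_left_mono norm_vec_restrict_le_sup) auto
    finally have block: "\<bar>\<phi> (vec_restrict T h)\<bar> \<le> D * (sqrt k * \<beta>)" .
    have "vec_restrict U h = vec_restrict T h + vec_restrict (U - T) h"
      using T by (subst vec_restrict_Un[symmetric]) (auto simp: Un_absorb1)
    then have "\<bar>\<phi> (vec_restrict U h)\<bar> \<le> \<bar>\<phi> (vec_restrict T h)\<bar> + \<bar>\<phi> (vec_restrict (U - T) h)\<bar>"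
      using assms(2) by (simp add: linear_add)
    also have "\<dots> \<le> D * (sqrt k * \<beta>) + D * (sqrt k * (m / k) + (\<Sum>i\<in>U - T. \<bar>h $ i\<bar>) / sqrt k)"
      using rest block by linarith
    also have "sqrt k * (m / k) = m / sqrt k"
      using assms(1) by (simp add: field_simps)
    also have "D * (sqrt k * \<beta>) + D * (m / sqrt k + (\<Sum>i\<in>U - T. \<bar>h $ i\<bar>) / sqrt k)
        = D * (sqrt k * \<beta> + (m + (\<Sum>i\<in>U - T. \<bar>h $ i\<bar>)) / sqrt k)"
      by (simp add: algebra_simps add_divide_distrib)
    also have "m + (\<Sum>i\<in>U - T. \<bar>h $ i\<bar>) = (\<Sum>i\<in>U. \<bar>h $ i\<bar>)"
      unfolding m_def using T by (subst sum.subset_diff[of T U]) (auto simp: add.commute)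
    finally show ?thesis .
  qed
qed

text \<open>One more step of the same telescoping: the top block \<open>T\<close> itself supplies the uniform bound
  \<open>\<beta>\<close> for the entries outside it, so its \<open>\<ell>\<^sub>1\<close> mass takes the place of the \<open>\<beta>\<close> term.\<close>

lemma top_entries_tail_bound:
  fixes h :: "real ^ 'n"
  assumes "0 < k"
  obtains T where "T \<subseteq> U" "card T \<le> k"
    and "\<And>\<phi> D. linear \<phi> \<Longrightarrow> 0 \<le> D \<Longrightarrow>
      (\<And>V. V \<subseteq> U - T \<Longrightarrow> card V \<le> k \<Longrightarrow> \<bar>\<phi> (vec_restrict V h)\<bar> \<le> D * norm (vec_restrict V h)) \<Longrightarrow>
      \<bar>\<phi> (vec_restrict (U - T) h)\<bar> \<le> D * ((\<Sum>i\<in>U. \<bar>h $ i\<bar>) / sqrt k)"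
proof -
  obtain T where T: "T \<subseteq> U" "card T \<le> k"
    "\<And>j. j \<in> U - T \<Longrightarrow> \<bar>h $ j\<bar> \<le> (\<Sum>i\<in>T. \<bar>h $ i\<bar>) / k"
    using exists_block_dominating_rest[OF assms, of U h] by metis
  show ?thesis
  proof (rule that[OF T(1,2)])
    fix \<phi> :: "real ^ 'n \<Rightarrow> real" and D :: real
    assume \<phi>: "linear \<phi>" "0 \<le> D"
      "\<And>V. V \<subseteq> U - T \<Longrightarrow> card V \<le> k \<Longrightarrow> \<bar>\<phi> (vec_restrict V h)\<bar> \<le> D * norm (vec_restrict V h)"
    define m where "m = (\<Sum>i\<in>T. \<bar>h $ i\<bar>)"
    have "0 \<le> m / k" by (simp add: m_def sum_nonneg)
    then have "\<bar>\<phi> (vec_restrict (U - T) h)\<bar>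
        \<le> D * (sqrt k * (m / k) + (\<Sum>i\<in>U - T. \<bar>h $ i\<bar>) / sqrt k)"
      using T(3) \<phi> assms
      by (intro sparse_functional_bound[where \<beta> = "m / k"]) (simp_all add: m_def)
    also have "sqrt k * (m / k) = m / sqrt k"
      using assms by (simp add: field_simps)
    also have "m / sqrt k + (\<Sum>i\<in>U - T. \<bar>h $ i\<bar>) / sqrt k = (\<Sum>i\<in>U. \<bar>h $ i\<bar>) / sqrt k"
      unfolding m_def add_divide_distrib[symmetric] using T
      by (subst sum.subset_diff[of T U]) (auto simp: add.commute)
    finally show "\<bar>\<phi> (vec_restrict (U - T) h)\<bar> \<le> D * ((\<Sum>i\<in>U. \<bar>h $ i\<bar>) / sqrt k)" .
  qed
qed

section \<open>Recovery under the restricted isometry property\<close>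

lemma rip_bound_nonneg:
  fixes A :: "real ^ 'n ^ 'm"
  assumes "rip_bound A s \<delta>" "0 < s"
  shows "0 \<le> \<delta>"
proof -
  let ?e = "axis undefined 1 :: real ^ 'n"
  have "{i. ?e $ i \<noteq> 0} = {undefined}" by (auto simp: axis_def)
  then have "sparse_vec s ?e" using assms(2) by (simp add: sparse_vec_def)
  then have "(1 - \<delta>) * (norm ?e)\<^sup>2 \<le> (1 + \<delta>) * (norm ?e)\<^sup>2"
    using assms(1) unfolding rip_bound_def by (meson order_trans)
  then show ?thesis by simp
qed

text \<open>Polarization: after rescaling both vectors to the same norm, \<open>u + v\<close> and \<open>u - v\<close> have equal
  norms, so the isometry bounds leave room only for a small difference between
  \<open>\<parallel>A (u + v)\<parallel>\<^sup>2\<close> and \<open>\<parallel>A (u - v)\<parallel>\<^sup>2\<close>, which is four times the inner product.\<close>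

lemma rip_disjoint_inner:
  fixes A :: "real ^ 'n ^ 'm"
  assumes rip: "rip_bound A (2 * k) \<delta>" and "0 < k"
    and card: "card T \<le> k" "card V \<le> k" and disj: "T \<inter> V = {}"
  shows "\<bar>(A *v vec_restrict T h) \<bullet> (A *v vec_restrict V h)\<bar>
    \<le> \<delta> * norm (vec_restrict T h) * norm (vec_restrict V h)"
proof (cases "vec_restrict T h = 0 \<or> vec_restrict V h = 0")
  case True
  then show ?thesis by auto
next
  case False
  let ?u = "vec_restrict T h" and ?v = "vec_restrict V h"
  define p where "p = norm ?u * norm ?v"
  have p: "0 < p" using False by (simp add: p_def)
  define u where "u = norm ?v *\<^sub>R ?u"
  define v where "v = norm ?u *\<^sub>R ?v"
  have nu: "u \<bullet> u = p\<^sup>2" and nv: "v \<bullet> v = p\<^sup>2"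
    by (simp_all add: u_def v_def p_def dot_square_norm power2_eq_square)
  have uv: "u \<bullet> v = 0"
    using inner_vec_restrict_disjoint[OF disj] by (simp add: u_def v_def)
  have cardTV: "card (T \<union> V) \<le> 2 * k"
    using card card_Un_le[of T V] by linarith
  have sp: "sparse_vec (2 * k) (a *\<^sub>R ?u + b *\<^sub>R ?v)" for a b
  proof -
    have "card {i. (a *\<^sub>R ?u + b *\<^sub>R ?v) $ i \<noteq> 0} \<le> card (T \<union> V)"
      by (rule card_mono) auto
    then show ?thesis using cardTV by (simp add: sparse_vec_def)
  qed
  have spp: "sparse_vec (2 * k) (u + v)"
    using sp[of "norm ?v" "norm ?u"] by (simp add: u_def v_def)
  have spm: "sparse_vec (2 * k) (u - v)"
    using sp[of "norm ?v" "- norm ?u"] by (simp add: u_def v_def)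
  have np: "(norm (u + v))\<^sup>2 = 2 * p\<^sup>2" and nm: "(norm (u - v))\<^sup>2 = 2 * p\<^sup>2"
    using nu nv uv by (simp_all add: power2_norm_eq_inner inner_simps inner_commute)
  have pol: "4 * ((A *v u) \<bullet> (A *v v)) = (norm (A *v (u + v)))\<^sup>2 - (norm (A *v (u - v)))\<^sup>2"
    by (simp add: power2_norm_eq_inner matrix_vector_right_distrib
        matrix_vector_mult_diff_distrib inner_simps inner_commute)
  have "\<bar>4 * ((A *v u) \<bullet> (A *v v))\<bar> \<le> 4 * \<delta> * p\<^sup>2"
    using rip[unfolded rip_bound_def, rule_format, OF spp]
      rip[unfolded rip_bound_def, rule_format, OF spm]
    unfolding pol np nm by (simp add: abs_le_iff algebra_simps)
  moreover have "(A *v u) \<bullet> (A *v v) = p * ((A *v ?u) \<bullet> (A *v ?v))"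
    by (simp add: u_def v_def p_def matrix_vector_mult_scaleR)
  ultimately have "p * \<bar>(A *v ?u) \<bullet> (A *v ?v)\<bar> \<le> p * (\<delta> * p)"
    using p by (simp add: abs_mult power2_eq_square algebra_simps)
  then have "\<bar>(A *v ?u) \<bullet> (A *v ?v)\<bar> \<le> \<delta> * p"
    using p by (simp only: mult_le_cancel_left_pos)
  then show ?thesis by (simp add: p_def mult.assoc)
qed

text \<open>The cone condition: whatever \<open>z\<close> spends off the support of \<open>x\<close> it has to save on it.\<close>

lemma l1_cone:
  fixes x z :: "real ^ 'n"
  assumes "l1_norm z \<le> l1_norm x" and "\<And>i. i \<notin> T \<Longrightarrow> x $ i = 0"
  shows "(\<Sum>i\<in>- T. \<bar>(z - x) $ i\<bar>) \<le> (\<Sum>i\<in>T. \<bar>(z - x) $ i\<bar>)"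
proof -
  have split: "(\<Sum>i\<in>UNIV. w i) = (\<Sum>i\<in>T. w i) + (\<Sum>i\<in>- T. w i)" for w :: "'n \<Rightarrow> real"
    by (subst sum.union_disjoint[symmetric]) auto
  have "(\<Sum>i\<in>- T. \<bar>(z - x) $ i\<bar>) = (\<Sum>i\<in>- T. \<bar>z $ i\<bar>)"
    using assms(2) by (intro sum.cong) auto
  moreover have "(\<Sum>i\<in>- T. \<bar>x $ i\<bar>) = 0"
    using assms(2) by (intro sum.neutral) auto
  moreover have "(\<Sum>i\<in>T. \<bar>x $ i\<bar>) - (\<Sum>i\<in>T. \<bar>z $ i\<bar>) \<le> (\<Sum>i\<in>T. \<bar>(z - x) $ i\<bar>)"
    unfolding sum_subtractf[symmetric] by (intro sum_mono) auto
  ultimately show ?thesis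
    using assms(1) unfolding l1_norm_def split by linarith
qed

lemma rip_l1_error_bound:
  fixes A :: "real ^ 'n ^ 'm"
  assumes rip: "rip_bound A (2 * k) \<delta>" and \<delta>: "\<delta> < sqrt 2 - 1" and k: "0 < k"
    and x: "sparse_vec k x" and l1: "l1_norm z \<le> l1_norm x"
    and fit: "norm (A *v (z - x)) \<le> \<epsilon>"
  shows "norm (z - x) \<le> 2 * sqrt (1 + \<delta>) / (1 - (1 + sqrt 2) * \<delta>) * \<epsilon>"
proof -
  define h where "h = z - x"
  define T0 where "T0 = {i. x $ i \<noteq> 0}"
  have T0: "card T0 \<le> k" using x by (simp add: T0_def sparse_vec_def)
  obtain T1 where T1: "T1 \<subseteq> - T0" "card T1 \<le> k"
    and tail: "\<And>\<phi> D. linear \<phi> \<Longrightarrow> 0 \<le> D \<Longrightarrow>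
      (\<And>V. V \<subseteq> - T0 - T1 \<Longrightarrow> card V \<le> k \<Longrightarrow>
        \<bar>\<phi> (vec_restrict V h)\<bar> \<le> D * norm (vec_restrict V h)) \<Longrightarrow>
      \<bar>\<phi> (vec_restrict (- T0 - T1) h)\<bar> \<le> D * ((\<Sum>i\<in>- T0. \<bar>h $ i\<bar>) / sqrt k)"
    using top_entries_tail_bound[OF k, of "- T0" h] by blast
  define h0 h1 h01 r where "h0 = vec_restrict T0 h" and "h1 = vec_restrict T1 h"
    and "h01 = vec_restrict (T0 \<union> T1) h" and "r = vec_restrict (- T0 - T1) h"
  have disj: "T0 \<inter> T1 = {}" using T1 by auto
  have h01: "h01 = h0 + h1"
    unfolding h01_def h0_def h1_def by (rule vec_restrict_Un[OF disj])
  have h: "h = h01 + r"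
    by (auto simp: h01_def r_def vec_eq_iff)
  have \<delta>0: "0 \<le> \<delta>" using rip_bound_nonneg[OF rip] k by simp
  have \<rho>: "0 < 1 - (1 + sqrt 2) * \<delta>"
  proof -
    have "(1 + sqrt 2) * \<delta> < (1 + sqrt 2) * (sqrt 2 - 1)"
      using \<delta> by (intro mult_strict_left_mono) (auto intro: add_pos_nonneg)
    then show ?thesis by (simp add: algebra_simps)
  qed

  have "(\<Sum>i\<in>- T0. \<bar>h $ i\<bar>) \<le> (\<Sum>i\<in>T0. \<bar>h $ i\<bar>)"
    unfolding h_def by (rule l1_cone[OF l1]) (simp add: T0_def)
  also have "\<dots> \<le> sqrt k * norm h0"
    unfolding h0_def by (rule l1_le_sqrt_card_mult_norm[OF T0])
  finally have mass: "(\<Sum>i\<in>- T0. \<bar>h $ i\<bar>) / sqrt k \<le> norm h0"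
    using k by (simp add: field_simps)
  have pyth: "(norm h01)\<^sup>2 = (norm h0)\<^sup>2 + (norm h1)\<^sup>2"
    unfolding h01_def h0_def h1_def norm_squared_vec_restrict
    using disj by (intro sum.union_disjoint) auto
  have h0_le: "norm h0 \<le> norm h01"
    using pyth by (simp add: power2_le_imp_le)
  have sum_le: "norm h0 + norm h1 \<le> sqrt 2 * norm h01"
  proof (rule power2_le_imp_le)
    have "0 \<le> (norm h0 - norm h1)\<^sup>2" by simp
    then show "(norm h0 + norm h1)\<^sup>2 \<le> (sqrt 2 * norm h01)\<^sup>2"
      unfolding power_mult_distrib pyth power2_sum power2_diff by simp
  qed simp

  \<comment> \<open>The tail bound with \<open>\<phi> = (\<bullet>) r\<close> controls the norm of the tail.\<close>
  have r_le: "norm r \<le> norm h01"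
  proof -
    have "\<bar>r \<bullet> r\<bar> \<le> norm r * ((\<Sum>i\<in>- T0. \<bar>h $ i\<bar>) / sqrt k)"
      using tail[of "(\<bullet>) r" "norm r", folded r_def, OF _ _ Cauchy_Schwarz_ineq2]
      by (simp add: bounded_linear.linear bounded_linear_inner_right)
    also have "\<dots> \<le> norm r * norm h01"
      using mass h0_le by (intro mult_left_mono) auto
    finally have "norm r * norm r \<le> norm r * norm h01"
      by (simp add: dot_square_norm power2_eq_square)
    then show ?thesis by (cases "r = 0") auto
  qed

  \<comment> \<open>The same bound with \<open>\<phi> = \<lambda>w. A h01 \<bullet> A w\<close> controls the cross term. The blocks \<open>T0\<close> and \<open>T1\<close>
    are treated separately because near orthogonality is available only for pairs of
    \<open>k\<close>-sparse vectors.\<close>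
  have cross: "\<bar>(A *v h01) \<bullet> (A *v r)\<bar> \<le> \<delta> * (sqrt 2 * norm h01) * norm h01"
  proof -
    have "\<bar>(A *v h01) \<bullet> (A *v r)\<bar> \<le> \<delta> * (norm h0 + norm h1) * ((\<Sum>i\<in>- T0. \<bar>h $ i\<bar>) / sqrt k)"
      unfolding r_def
    proof (rule tail[of "\<lambda>w. (A *v h01) \<bullet> (A *v w)"])
      show "linear (\<lambda>w. (A *v h01) \<bullet> (A *v w))"
        by (rule linearI) (simp_all add: matrix_vector_right_distrib
            matrix_vector_mult_scaleR inner_simps)
      show "0 \<le> \<delta> * (norm h0 + norm h1)" using \<delta>0 by simp
      fix V assume V: "V \<subseteq> - T0 - T1" "card V \<le> k"
      let ?v = "vec_restrict V h"
      have "\<bar>(A *v h0) \<bullet> (A *v ?v)\<bar> \<le> \<delta> * norm h0 * norm ?v"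
        unfolding h0_def using V T0 by (intro rip_disjoint_inner[OF rip k]) auto
      moreover have "\<bar>(A *v h1) \<bullet> (A *v ?v)\<bar> \<le> \<delta> * norm h1 * norm ?v"
        unfolding h1_def using V T1 by (intro rip_disjoint_inner[OF rip k]) auto
      ultimately show "\<bar>(A *v h01) \<bullet> (A *v ?v)\<bar> \<le> \<delta> * (norm h0 + norm h1) * norm ?v"
        unfolding h01 matrix_vector_right_distrib inner_add_left ring_distribs by linarith
    qed
    also have "\<dots> \<le> \<delta> * (sqrt 2 * norm h01) * norm h01"
      using \<delta>0 sum_le mass h0_le
      by (intro mult_mono) (auto intro!: divide_nonneg_nonneg sum_nonneg)
    finally show ?thesis .
  qed

  have "sparse_vec (2 * k) h01"
    unfolding h01_def using card_Un_le[of T0 T1] T0 T1 by (intro sparse_vec_restrict) linarith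
  then have lower: "(1 - \<delta>) * (norm h01)\<^sup>2 \<le> (norm (A *v h01))\<^sup>2"
    and upper: "(norm (A *v h01))\<^sup>2 \<le> (1 + \<delta>) * (norm h01)\<^sup>2"
    using rip unfolding rip_bound_def by auto
  have "norm (A *v h01) \<le> sqrt (1 + \<delta>) * norm h01"
    using upper \<delta>0 by (intro power2_le_imp_le[where x = "norm (A *v h01)"]) (auto simp: power_mult_distrib)
  then have noise: "\<bar>(A *v h01) \<bullet> (A *v h)\<bar> \<le> sqrt (1 + \<delta>) * norm h01 * \<epsilon>"
    using fit \<delta>0 unfolding h_def
    by (intro order_trans[OF Cauchy_Schwarz_ineq2] mult_mono) auto
  have "(norm (A *v h01))\<^sup>2 = (A *v h01) \<bullet> (A *v h) - (A *v h01) \<bullet> (A *v r)"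
    unfolding h matrix_vector_right_distrib by (simp add: power2_norm_eq_inner inner_simps)
  also have "\<dots> \<le> sqrt (1 + \<delta>) * norm h01 * \<epsilon> + \<delta> * (sqrt 2 * norm h01) * norm h01"
    using noise cross by linarith
  finally have "norm h01 * ((1 - (1 + sqrt 2) * \<delta>) * norm h01) \<le> norm h01 * (sqrt (1 + \<delta>) * \<epsilon>)"
    using lower by (simp add: power2_eq_square algebra_simps)
  moreover have "0 \<le> \<epsilon>" using fit norm_ge_zero order_trans by blast
  ultimately have "(1 - (1 + sqrt 2) * \<delta>) * norm h01 \<le> sqrt (1 + \<delta>) * \<epsilon>"
    using \<delta>0 by (cases "h01 = 0") auto
  then have "norm h01 \<le> sqrt (1 + \<delta>) / (1 - (1 + sqrt 2) * \<delta>) * \<epsilon>"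
    using \<rho> by (simp add: field_simps)
  moreover have "norm h \<le> 2 * norm h01"
    using norm_triangle_ineq[of h01 r] r_le h by simp
  ultimately show ?thesis unfolding h_def by simp
qed

section \<open>Point measures\<close>

lemma emeasure_point_meas_ennreal:
  assumes "A \<subseteq> S" "\<And>i. i \<in> I \<Longrightarrow> 0 \<le> c i"
  shows "emeasure (point_meas S I c p) A = ennreal (\<Sum>i\<in>I. c i * indicator A (p i))"
proof -
  have "emeasure (point_meas S I c p) A = (\<Sum>i\<in>I. ennreal (c i * indicator A (p i)))"
    unfolding emeasure_point_meas[OF assms(1)] emeasure_dirac[OF assms(1)]
    by (intro sum.cong) (auto simp: indicator_def)
  also have "\<dots> = ennreal (\<Sum>i\<in>I. c i * indicator A (p i))"
    using assms(2) by (intro sum_ennreal) simp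
  finally show ?thesis .
qed

lemma measure_point_meas:
  assumes "A \<subseteq> S" "\<And>i. i \<in> I \<Longrightarrow> 0 \<le> c i"
  shows "measure (point_meas S I c p) A = (\<Sum>i\<in>I. c i * indicator A (p i))"
proof -
  have "0 \<le> (\<Sum>i\<in>I. c i * indicator A (p i))"
    using assms(2) by (intro sum_nonneg) auto
  moreover have "emeasure (point_meas S I c p) A = ennreal (\<Sum>i\<in>I. c i * indicator A (p i))"
    using assms by (rule emeasure_point_meas_ennreal)
  ultimately show ?thesis by (simp add: measure_def)
qed

text \<open>Off the finitely many atoms the measure vanishes, so every integrand agrees almost
  everywhere with a simple function.\<close>

lemma integral_point_meas:
  fixes f :: "'a \<Rightarrow> real"
  assumes fin: "finite I" and c: "\<And>i. i \<in> I \<Longrightarrow> 0 \<le> c i" and p: "\<And>i. i \<in> I \<Longrightarrow> p i \<in> S"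
  shows "integral\<^sup>L (point_meas S I c p) f = (\<Sum>i\<in>I. c i * f (p i))"
proof -
  let ?M = "point_meas S I c p"
  define P where "P = p ` I"
  have P: "finite P" "P \<subseteq> S" using fin p by (auto simp: P_def)
  have meas: "g \<in> borel_measurable ?M" for g :: "'a \<Rightarrow> real"
    by (rule measurableI) auto
  have "emeasure ?M (S - P) = 0"
    using c by (subst emeasure_point_meas_ennreal) (auto simp: P_def indicator_def intro!: sum.neutral)
  then have "AE x in ?M. x \<in> P"
    by (intro AE_I[where N = "S - P"]) auto
  then have "AE x in ?M. f x = (\<Sum>a\<in>P. indicator {a} x *\<^sub>R f a)"
  proof (rule AE_mp, intro AE_I2 impI)
    fix x assume "x \<in> P"
    then have "(\<Sum>a\<in>P. indicator {a} x *\<^sub>R f a) = (\<Sum>a\<in>{x}. indicator {a} x *\<^sub>R f a)"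
      using P by (intro sum.mono_neutral_right) (auto simp: indicator_def)
    then show "f x = (\<Sum>a\<in>P. indicator {a} x *\<^sub>R f a)" by simp
  qed
  then have "integral\<^sup>L ?M f = (\<integral>x. (\<Sum>a\<in>P. indicator {a} x *\<^sub>R f a) \<partial>?M)"
    by (intro integral_cong_AE meas)
  also have "\<dots> = (\<Sum>a\<in>P. measure ?M {a} *\<^sub>R f a)"
  proof -
    have "has_bochner_integral ?M (\<lambda>x. indicator {a} x *\<^sub>R f a) (measure ?M {a} *\<^sub>R f a)"
      if "a \<in> P" for a
    proof (rule has_bochner_integral_indicator)
      show "{a} \<in> sets ?M" using that P by auto
      show "emeasure ?M {a} < \<infinity>"
        using that P c by (subst emeasure_point_meas_ennreal) auto
    qed
    then show ?thesis
      by (intro has_bochner_integral_integral_eq has_bochner_integral_sum)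
  qed
  also have "\<dots> = (\<Sum>a\<in>P. \<Sum>i\<in>I. c i * indicator {a} (p i) * f a)"
    using P c by (intro sum.cong refl, subst measure_point_meas) (auto simp: sum_distrib_right)
  also have "\<dots> = (\<Sum>i\<in>I. \<Sum>a\<in>P. c i * indicator {a} (p i) * f a)"
    by (rule sum.swap)
  also have "\<dots> = (\<Sum>i\<in>I. c i * f (p i))"
  proof (rule sum.cong[OF refl])
    fix i assume "i \<in> I"
    then have "(\<Sum>a\<in>P. c i * indicator {a} (p i) * f a)
        = (\<Sum>a\<in>{p i}. c i * indicator {a} (p i) * f a)"
      using P by (intro sum.mono_neutral_right) (auto simp: P_def indicator_def)
    then show "(\<Sum>a\<in>P. c i * indicator {a} (p i) * f a) = c i * f (p i)" by simp
  qed
  finally show ?thesis .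
qed

lemma atom_in_measure_support:
  assumes "finite I" "\<And>i. i \<in> I \<Longrightarrow> 0 \<le> c i" "i \<in> I" "0 < c i" "p i \<in> S"
  shows "p i \<in> measure_support (point_meas S I c p)"
  unfolding measure_support_def
proof (clarsimp simp: assms(5))
  fix U assume "p i \<in> U"
  then have "c i \<le> (\<Sum>j\<in>I. c j * indicator (U \<inter> S) (p j))"
    using assms member_le_sum[of i I "\<lambda>j. c j * indicator (U \<inter> S) (p j)"] by simp
  then show "0 < emeasure (point_meas S I c p) (U \<inter> S)"
    using assms by (subst emeasure_point_meas_ennreal) auto
qed

text \<open>Several atoms may sit at the same node, so their weights are added; since every node with
  nonzero coefficient receives some atom, the resulting vector has at most as many nonzero
  entries as there are atoms. Phrasing the conclusion for an arbitrary test function \<open>\<psi>\<close> gives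
  equality of moments and of measures at once.\<close>

lemma collect_weights_at_nodes:
  fixes q :: "'N::finite \<Rightarrow> 'a"
  assumes "inj q" "finite I" "\<And>i. i \<in> I \<Longrightarrow> g i \<noteq> 0 \<Longrightarrow> y i \<in> range q"
  obtains x :: "real ^ 'N" where "sparse_vec (card I) x"
    and "\<And>\<psi>. (\<Sum>i\<in>I. g i * \<psi> (y i)) = (\<Sum>j\<in>UNIV. x $ j * \<psi> (q j))"
proof
  define x :: "real ^ 'N" where "x = (\<chi> j. \<Sum>i\<in>I. if y i = q j then g i else 0)"
  have "{j. x $ j \<noteq> 0} \<subseteq> (\<lambda>i. inv q (y i)) ` I"
  proof
    fix j assume "j \<in> {j. x $ j \<noteq> 0}"
    then obtain i where "i \<in> I" "y i = q j"
      unfolding x_def by (auto elim!: sum.not_neutral_contains_not_neutral split: if_splits)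
    then show "j \<in> (\<lambda>i. inv q (y i)) ` I"
      using assms(1) by (auto intro!: image_eqI[of _ _ i])
  qed
  then show "sparse_vec (card I) x"
    unfolding sparse_vec_def using assms(2) surj_card_le by blast
  fix \<psi> :: "'a \<Rightarrow> real"
  have "(\<Sum>j\<in>UNIV. x $ j * \<psi> (q j))
      = (\<Sum>j\<in>UNIV. \<Sum>i\<in>I. (if y i = q j then g i else 0) * \<psi> (q j))"
    by (simp add: x_def sum_distrib_right)
  also have "\<dots> = (\<Sum>i\<in>I. \<Sum>j\<in>UNIV. (if y i = q j then g i else 0) * \<psi> (q j))"
    by (rule sum.swap)
  also have "\<dots> = (\<Sum>i\<in>I. g i * \<psi> (y i))"
  proof (rule sum.cong[OF refl])
    fix i assume i: "i \<in> I"
    show "(\<Sum>j\<in>UNIV. (if y i = q j then g i else 0) * \<psi> (q j)) = g i * \<psi> (y i)"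
    proof (cases "g i = 0")
      case True
      then show ?thesis by (simp add: if_distrib cong: if_cong)
    next
      case False
      then obtain j0 where j0: "y i = q j0" using assms(3)[OF i] by auto
      then have "(\<Sum>j\<in>UNIV. (if y i = q j then g i else 0) * \<psi> (q j))
          = (\<Sum>j\<in>{j0}. (if y i = q j then g i else 0) * \<psi> (q j))"
        using assms(1) by (intro sum.mono_neutral_right) (auto dest: injD)
      then show ?thesis using j0 by simp
    qed
  qed
  finally show "(\<Sum>i\<in>I. g i * \<psi> (y i)) = (\<Sum>j\<in>UNIV. x $ j * \<psi> (q j))" ..
qed

section \<open>Recovery of point measures\<close>

theorem theoremA:
  fixes S :: "(real ^ 'n) set"
    and q :: "'N::finite \<Rightarrow> real ^ 'n"
    and f :: "'m::finite \<Rightarrow> real ^ 'n \<Rightarrow> real"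
    and M :: "real ^ 'N ^ 'm"
    and k :: nat
  assumes "S = sphere 0 1"
    and "inj q" and "range q \<subseteq> S"
    and "M = (\<chi> i j. f i (q j))"
    and "0 < k"
    and "rip_const M (2 * k) < sqrt 2 - 1"
  shows "\<exists>B\<^sub>1::real. \<forall>(g :: nat \<Rightarrow> real) (y :: nat \<Rightarrow> real ^ 'n) \<mu>.
    (\<forall>i\<in>{1..k}. 0 \<le> g i \<and> y i \<in> S) \<and> \<mu> = point_meas S {1..k} g y \<longrightarrow>
      (measure_support \<mu> \<subseteq> range q \<longrightarrow>
        (\<forall>c. is_arg_min l1_norm (\<lambda>c. M *v c = moments f \<mu>) c \<longrightarrow>
          (\<forall>A\<in>sets \<mu>. measure \<mu> A = (\<Sum>i\<in>UNIV. c $ i * measure (dirac S (q i)) A)))) \<and>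
      (\<forall>\<tau> \<nu> c\<^sub>\<nu> c.
        0 \<le> \<tau> \<and>
        (\<forall>i. 0 \<le> c\<^sub>\<nu> $ i) \<and> sparse_vec k c\<^sub>\<nu> \<and> \<nu> = point_meas S UNIV (($) c\<^sub>\<nu>) q \<and>
        norm (moments f \<mu> - moments f \<nu>) \<le> \<tau> \<and>
        is_arg_min l1_norm (\<lambda>c. norm (M *v c - moments f \<mu>) \<le> \<tau>) c \<longrightarrow>
          norm (c - c\<^sub>\<nu>) \<le> B\<^sub>1 * \<tau>)"
proof -
  define \<delta> where "\<delta> = rip_const M (2 * k)"
  define B where "B = 2 * sqrt (1 + \<delta>) / (1 - (1 + sqrt 2) * \<delta>)"
  have rip: "rip_bound M (2 * k) \<delta>"
    unfolding \<delta>_def using \<open>0 < k\<close> by (intro rip_bound_rip_const) simp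
  have recovery: "norm (c - x) \<le> B * \<epsilon>"
    if "sparse_vec k x" "l1_norm c \<le> l1_norm x" "norm (M *v (c - x)) \<le> \<epsilon>" for c x \<epsilon>
    unfolding B_def using assms that
    by (intro rip_l1_error_bound[OF rip]) (auto simp: \<delta>_def)
  have M: "M *v c = (\<chi> j. \<Sum>i\<in>UNIV. c $ i * f j (q i))" for c
    using assms(4) by (simp add: matrix_vector_mult_def mult.commute)
  have qS: "q i \<in> S" for i using assms(3) by auto

  have exact_recovery: "measure \<mu> A = (\<Sum>i\<in>UNIV. c $ i * measure (dirac S (q i)) A)"
    if g: "\<forall>i\<in>{1..k}. 0 \<le> g i \<and> y i \<in> S" and \<mu>: "\<mu> = point_meas S {1..k} g y"
      and supp: "measure_support \<mu> \<subseteq> range q"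
      and min: "is_arg_min l1_norm (\<lambda>c. M *v c = moments f \<mu>) c" and A: "A \<in> sets \<mu>"
    for g y \<mu> c A
  proof -
    have "y i \<in> range q" if "i \<in> {1..k}" "g i \<noteq> 0" for i
      using atom_in_measure_support[of "{1..k}" g i y S] that g supp unfolding \<mu>
      by (force simp: less_le)
    then obtain x where x: "sparse_vec (card {1..k}) x"
      "\<And>\<psi>. (\<Sum>i\<in>{1..k}. g i * \<psi> (y i)) = (\<Sum>j\<in>UNIV. x $ j * \<psi> (q j))"
      by (rule collect_weights_at_nodes[OF assms(2) finite_atLeastAtMost]) auto
    have "integral\<^sup>L \<mu> (f i) = (\<Sum>j\<in>UNIV. x $ j * f i (q j))" for i
      unfolding \<mu> x(2)[symmetric] using g by (intro integral_point_meas) auto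
    then have "moments f \<mu> = M *v x"
      by (simp add: moments_def M)
    then have "M *v (c - x) = 0" "l1_norm c \<le> l1_norm x"
      using min by (auto simp: is_arg_min_def matrix_vector_mult_diff_distrib not_less)
    then have "c = x" using recovery[of x c 0] x(1) by simp
    moreover have AS: "A \<subseteq> S" using A \<mu> by simp
    then have "measure \<mu> A = (\<Sum>j\<in>UNIV. x $ j * indicator A (q j))"
      unfolding \<mu> x(2)[symmetric] using g by (intro measure_point_meas) auto
    moreover have "measure (dirac S (q i)) A = indicator A (q i)" for i
      using emeasure_dirac[OF AS, of "q i"] by (simp add: measure_def indicator_def)
    ultimately show ?thesis by simp
  qed

  have approx_recovery: "norm (c - c\<^sub>\<nu>) \<le> 2 * B * \<tau>"
    if c\<nu>: "\<forall>i. 0 \<le> c\<^sub>\<nu> $ i" "sparse_vec k c\<^sub>\<nu>"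
      and close: "norm (b - moments f (point_meas S UNIV (($) c\<^sub>\<nu>) q)) \<le> \<tau>"
      and min: "is_arg_min l1_norm (\<lambda>c. norm (M *v c - b) \<le> \<tau>) c"
    for b c\<^sub>\<nu> c \<tau>
  proof -
    have "moments f (point_meas S UNIV (($) c\<^sub>\<nu>) q) = M *v c\<^sub>\<nu>"
      unfolding moments_def M using c\<nu>(1) qS
      by (subst integral_point_meas) (auto simp: vec_eq_iff)
    with close have feas: "norm (M *v c\<^sub>\<nu> - b) \<le> \<tau>" by (simp add: norm_minus_commute)
    have "norm (M *v (c - c\<^sub>\<nu>)) \<le> norm (M *v c - b) + norm (M *v c\<^sub>\<nu> - b)"
      unfolding matrix_vector_mult_diff_distrib
      using norm_triangle_ineq4[of "M *v c - b" "M *v c\<^sub>\<nu> - b"] by simp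
    also have "\<dots> \<le> 2 * \<tau>" using min feas by (simp add: is_arg_min_def)
    finally have "norm (c - c\<^sub>\<nu>) \<le> B * (2 * \<tau>)"
      using min feas c\<nu> by (intro recovery) (auto simp: is_arg_min_def not_less)
    then show ?thesis by simp
  qed

  show ?thesis
  proof (intro exI[of _ "2 * B"] allI impI conjI ballI; elim conjE)
    fix g y \<mu> c A
    assume "\<forall>i\<in>{1..k}. 0 \<le> g i \<and> y i \<in> S" "\<mu> = point_meas S {1..k} g y"
      "measure_support \<mu> \<subseteq> range q" "is_arg_min l1_norm (\<lambda>c. M *v c = moments f \<mu>) c"
      "A \<in> sets \<mu>"
    then show "measure \<mu> A = (\<Sum>i\<in>UNIV. c $ i * measure (dirac S (q i)) A)"
      by (rule exact_recovery)
  next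
    fix \<mu> \<tau> \<nu> c\<^sub>\<nu> c
    assume \<nu>: "\<nu> = point_meas S UNIV (($) c\<^sub>\<nu>) q" and "\<forall>i. 0 \<le> c\<^sub>\<nu> $ i" "sparse_vec k c\<^sub>\<nu>"
      "norm (moments f \<mu> - moments f \<nu>) \<le> \<tau>"
      "is_arg_min l1_norm (\<lambda>c. norm (M *v c - moments f \<mu>) \<le> \<tau>) c"
    then show "norm (c - c\<^sub>\<nu>) \<le> 2 * B * \<tau>"
      unfolding \<nu> by (intro approx_recovery)
  qed
qed

end
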